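(* Let $T\in\mathcal M_n(\mathbb C)$ and let $e,f,g,h$ be non-negative continuous functions on $[0,\infty)$ such that $f(t)g(t)=t$ and $e(t)h(t)=t$ for all $t\ge0$. Then for every $p>0$, $$w_p(T)\le\frac12\big\|g^2(|T^*|)+h^2(|T|)\big\|^{1/2}\,\big\|f^2(|T|)+e^2(|T^*|)\big\|_{p/2}^{1/2}.$$
   Context: $|T|=(T^*T)^{1/2}$, $|T^*|=(TT^* )^{1/2}$; functions of positive matrices via functional calculus. Singular values $s_1(T)\ge\dots\ge s_n(T)$ are the eigenvalues of $|T|$; $\|T\|=s_1(T)$; for $p>0$, $\|T\|_p=(\sum_j s_j^p(T))^{1/p}$. $\mathrm{Re}(T)=\frac12(T+T^* )$, and $w_p(T)=\max\{\|\mathrm{Re}(\lambda T)\|_p:\lambda\in\mathbb C,|\lambda|=1\}$. *)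

theory Defs
  imports Complex_Main "Jordan_Normal_Form.Matrix"
begin

definition adj :: "complex mat \<Rightarrow> complex mat" where
  "adj A = mat (dim_col A) (dim_row A) (\<lambda>(i,j). cnj (A $$ (j,i)))"

definition unitary :: "nat \<Rightarrow> complex mat \<Rightarrow> bool" where
  "unitary n U \<longleftrightarrow> U \<in> carrier_mat n n \<and> U * adj U = 1\<^sub>m n \<and> adj U * U = 1\<^sub>m n"

definition rdiag :: "nat \<Rightarrow> (nat \<Rightarrow> real) \<Rightarrow> complex mat" where
  "rdiag n d = mat n n (\<lambda>(i,j). if i = j then complex_of_real (d i) else 0)"

definition spec_decomp :: "complex mat \<Rightarrow> complex mat \<Rightarrow> (nat \<Rightarrow> real) \<Rightarrow> bool" where
  "spec_decomp A U d \<longleftrightarrow> A \<in> carrier_mat (dim_row A) (dim_row A) \<and>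
     unitary (dim_row A) U \<and> A = U * rdiag (dim_row A) d * adj U"

definition matfun :: "(real \<Rightarrow> real) \<Rightarrow> complex mat \<Rightarrow> complex mat" where
  "matfun f A = (SOME B. \<exists>U d. spec_decomp A U d \<and> B = U * rdiag (dim_row A) (f \<circ> d) * adj U)"

definition mabs :: "complex mat \<Rightarrow> complex mat" where
  "mabs T = matfun sqrt (adj T * T)"

definition sing_vals :: "complex mat \<Rightarrow> nat \<Rightarrow> real" where
  "sing_vals T = (SOME s. \<exists>U. spec_decomp (mabs T) U s)"

definition op_norm :: "complex mat \<Rightarrow> real" where
  "op_norm T = Max (sing_vals T ` {..<dim_row T})"

definition schatten :: "real \<Rightarrow> complex mat \<Rightarrow> real" where
  "schatten p T = (\<Sum>j<dim_row T. sing_vals T j powr p) powr (1 / p)"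

definition re_part :: "complex mat \<Rightarrow> complex mat" where
  "re_part T = (1/2 :: complex) \<cdot>\<^sub>m (T + adj T)"

definition w_p :: "real \<Rightarrow> complex mat \<Rightarrow> real" where
  "w_p p T = (SUP z\<in>{z::complex. cmod z = 1}. schatten p (re_part (z \<cdot>\<^sub>m T)))"

end

theory Submission
  imports Defs "Jordan_Normal_Form.Spectral_Radius" "HOL-Analysis.L2_Norm"
begin

text \<open>
  Write \<open>Q = Re (z T)\<close> with \<open>|z| = 1\<close>, \<open>G = g\<^sup>2(|T\<^sup>*|) + h\<^sup>2(|T|)\<close> and \<open>B = f\<^sup>2(|T|) + e\<^sup>2(|T\<^sup>*|)\<close>.
  The mixed Schwarz inequality
  \<open>|\<langle>T x, y\<rangle>|\<^sup>2 \<le> \<langle>f\<^sup>2(|T|) x, x\<rangle> \<langle>g\<^sup>2(|T\<^sup>*|) y, y\<rangle>\<close>, applied to \<open>T\<close> with \<open>(f, g)\<close> and to \<open>T\<^sup>*\<close>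
  with \<open>(e, h)\<close> and \<open>y = Q x\<close>, gives \<open>\<parallel>Q x\<parallel>\<^sup>2 \<le> \<kappa> \<langle>B x, x\<rangle>\<close> with \<open>\<kappa> = \<parallel>G\<parallel> / 4\<close>.
  By a dimension count (Weyl monotonicity), the \<open>j\<close>-th largest \<open>s\<^sub>j(Q)\<^sup>2\<close> is at most \<open>\<kappa>\<close> times the
  \<open>j\<close>-th largest \<open>s\<^sub>j(B)\<close>; summing the powers \<open>p / 2\<close> gives the bound, with no triangle inequality for
  the \<open>p\<close>-norm, so that \<open>p < 1\<close> is allowed.
\<close>

section \<open>Adjoints, diagonal and unitary matrices\<close>

lemma dim_adj [simp]: "dim_row (adj A) = dim_col A" "dim_col (adj A) = dim_row A"
  by (simp_all add: adj_def)

lemma index_adj [simp]: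
  "i < dim_col A \<Longrightarrow> j < dim_row A \<Longrightarrow> adj A $$ (i, j) = cnj (A $$ (j, i))"
  by (simp add: adj_def)

lemma adj_carrier [simp, intro]: "A \<in> carrier_mat n m \<Longrightarrow> adj A \<in> carrier_mat m n"
  by (auto simp: adj_def)

lemma adj_adj [simp]: "adj (adj A) = A"
  by (rule eq_matI) auto

lemma adj_mult:
  assumes "A \<in> carrier_mat n m" "B \<in> carrier_mat m k"
  shows "adj (A * B) = adj B * adj A"
  using assms by (intro eq_matI) (auto simp: scalar_prod_def mult.commute intro!: sum.cong)

lemma adj_smult [simp]: "adj (c \<cdot>\<^sub>m A) = cnj c \<cdot>\<^sub>m adj A"
  by (rule eq_matI) auto

lemma adj_one [simp]: "adj (1\<^sub>m n) = 1\<^sub>m n"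
  by (rule eq_matI) auto

lemma rdiag_carrier [simp, intro]: "rdiag n d \<in> carrier_mat n n"
  by (simp add: rdiag_def)

lemma dim_rdiag [simp]: "dim_row (rdiag n d) = n" "dim_col (rdiag n d) = n"
  by (simp_all add: rdiag_def)

lemma index_rdiag [simp]:
  "i < n \<Longrightarrow> j < n \<Longrightarrow> rdiag n d $$ (i, j) = (if i = j then complex_of_real (d i) else 0)"
  by (simp add: rdiag_def)

lemma adj_rdiag [simp]: "adj (rdiag n d) = rdiag n d"
  by (rule eq_matI) auto

lemma index_rdiag_mult [simp]:
  assumes "W \<in> carrier_mat n m" "i < n" "j < m"
  shows "(rdiag n d * W) $$ (i, j) = d i * W $$ (i, j)"
proof -
  have "(rdiag n d * W) $$ (i, j) = (\<Sum>k<n. (if i = k then complex_of_real (d i) else 0) * W $$ (k, j))"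
    using assms by (auto simp: scalar_prod_def atLeast0LessThan intro!: sum.cong)
  also have "\<dots> = (\<Sum>k<n. if i = k then d i * W $$ (k, j) else 0)"
    by (rule sum.cong) auto
  finally show ?thesis using assms by simp
qed

lemma index_mult_rdiag [simp]:
  assumes "W \<in> carrier_mat m n" "i < m" "j < n"
  shows "(W * rdiag n d) $$ (i, j) = W $$ (i, j) * d j"
proof -
  have "(W * rdiag n d) $$ (i, j) = (\<Sum>k<n. W $$ (i, k) * (if k = j then complex_of_real (d k) else 0))"
    using assms by (auto simp: scalar_prod_def atLeast0LessThan intro!: sum.cong)
  also have "\<dots> = (\<Sum>k<n. if k = j then W $$ (i, k) * d j else 0)"
    by (rule sum.cong) auto
  finally show ?thesis using assms by simp
qed

lemma rdiag_mult_rdiag: "rdiag n d * rdiag n d' = rdiag n (\<lambda>i. d i * d' i)"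
  by (rule eq_matI) (simp_all add: index_rdiag_mult[OF rdiag_carrier] del: index_mult_mat(1))

lemma unitary_carrier: "unitary n U \<Longrightarrow> U \<in> carrier_mat n n"
  by (simp add: unitary_def)

lemma unitary_adj: "unitary n U \<Longrightarrow> unitary n (adj U)"
  by (auto simp: unitary_def)

text \<open>With products associated to the right, these equations cancel a unitary against its
  adjoint inside a longer chain, where \<open>U * adj U = 1\<^sub>m n\<close> by itself does not
  match.\<close>

lemma unitary_cancel:
  assumes "unitary n U" "X \<in> carrier_mat n m"
  shows "U * (adj U * X) = X" "adj U * (U * X) = X"
proof -
  have U: "U \<in> carrier_mat n n" "U * adj U = 1\<^sub>m n" "adj U * U = 1\<^sub>m n"
    using assms by (auto simp: unitary_def)
  show "U * (adj U * X) = X"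
    using assoc_mult_mat[OF U(1) adj_carrier[OF U(1)] assms(2)] U(2) assms(2) by simp
  show "adj U * (U * X) = X"
    using assoc_mult_mat[OF adj_carrier[OF U(1)] U(1) assms(2)] U(3) assms(2) by simp
qed

lemma unitary_mult:
  assumes "unitary n U" "unitary n V"
  shows "unitary n (U * V)"
proof -
  have c: "U \<in> carrier_mat n n" "V \<in> carrier_mat n n" "adj U \<in> carrier_mat n n" "adj V \<in> carrier_mat n n"
    using assms unitary_carrier by auto
  have e: "U * adj U = 1\<^sub>m n" "adj V * V = 1\<^sub>m n" using assms by (auto simp: unitary_def)
  show ?thesis unfolding unitary_def
    using c e unitary_cancel(1)[OF assms(2) c(3)] unitary_cancel(2)[OF assms(1) c(2)]
    by (simp add: adj_mult[OF c(1,2)] assoc_mult_mat[of _ n n _ n _ n] mult_carrier_mat[of _ n n _ n])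
qed

definition vnorm2 :: "complex vec \<Rightarrow> real" where
  "vnorm2 x = (\<Sum>i<dim_vec x. (cmod (x $ i))\<^sup>2)"

lemma cscalar_prod_self: "x \<bullet>c x = complex_of_real (vnorm2 x)"
  by (auto simp: scalar_prod_def vnorm2_def atLeast0LessThan simp flip: complex_norm_square intro!: sum.cong)

lemma vnorm2_nonneg [simp]: "0 \<le> vnorm2 x"
  by (simp add: vnorm2_def sum_nonneg)

lemma vnorm2_eq_0: "vnorm2 x = 0 \<longleftrightarrow> x = 0\<^sub>v (dim_vec x)"
proof
  assume "vnorm2 x = 0"
  then show "x = 0\<^sub>v (dim_vec x)"
    unfolding vnorm2_def by (subst (asm) sum_nonneg_eq_0_iff) (auto intro!: eq_vecI)
next
  assume "x = 0\<^sub>v (dim_vec x)"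
  then show "vnorm2 x = 0" by (metis (mono_tags, lifting) index_zero_vec(1) lessThan_iff norm_zero sum.neutral vnorm2_def zero_power2)
qed

lemma vnorm2_smult: "vnorm2 (c \<cdot>\<^sub>v x) = (cmod c)\<^sup>2 * vnorm2 x"
  by (simp add: vnorm2_def norm_mult power_mult_distrib sum_distrib_left)

section \<open>The spectral theorem\<close>

text \<open>A Householder reflection exchanging the first basis vector and \<open>u\<close>;
  it exists because \<open>u $ 0\<close> is real.\<close>

lemma householder:
  assumes u: "u \<in> carrier_vec n" "vnorm2 u = 1" and n: "0 < n" and r: "u $ 0 = complex_of_real r"
  obtains W where "unitary n W" "adj W = W" "\<And>i. i < n \<Longrightarrow> W $$ (i, 0) = u $ i"
proof (cases "r = 1")
  case True
  \<comment> \<open>Here the first coordinate already exhausts the norm of \<open>u\<close>, so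
    \<open>u\<close> is the first basis vector and the identity matrix serves as
    \<open>W\<close>.\<close>
  have "vnorm2 u = (\<Sum>i\<in>{..<n} - {0}. (cmod (u $ i))\<^sup>2) + (cmod (u $ 0))\<^sup>2"
    using u(1) n by (simp add: vnorm2_def sum.remove[of "{..<n}" 0])
  then have "(\<Sum>i\<in>{..<n} - {0}. (cmod (u $ i))\<^sup>2) = 0"
    using True u(2) r by simp
  then have z: "\<forall>i\<in>{..<n} - {0}. (cmod (u $ i))\<^sup>2 = 0"
    by (subst (asm) sum_nonneg_eq_0_iff) auto
  show ?thesis
    by (rule that[of "1\<^sub>m n"]) (use z r True in \<open>auto simp: unitary_def\<close>)
next
  case False
  \<comment> \<open>With \<open>w\<close> the difference of \<open>u\<close> and the first basis
    vector, the squared norm of \<open>w\<close> is \<open>2 * (1 - r)\<close>. Thus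
    \<open>a\<close> is 2 divided by that squared norm, and \<open>W\<close> is the reflection in
    the hyperplane orthogonal to \<open>w\<close>.\<close>
  define a where "a = 1 / (1 - r)"
  define w where "w i = u $ i - (if i = 0 then 1 else 0)" for i
  define W where "W = mat n n (\<lambda>(i, j). (if i = j then 1 else 0) - a * w i * cnj (w j))"
  have W: "W \<in> carrier_mat n n" by (simp add: W_def)
  have ar: "a * (1 - r) = 1" using False by (simp add: a_def)
  have "(\<Sum>i<n. (cmod (w i))\<^sup>2) = (\<Sum>i\<in>{..<n} - {0}. (cmod (u $ i))\<^sup>2) + (r - 1)\<^sup>2"
    using n r by (simp add: w_def sum.remove[of "{..<n}" 0] cmod_def)
  also have "\<dots> = (\<Sum>i<n. (cmod (u $ i))\<^sup>2) - r\<^sup>2 + (r - 1)\<^sup>2"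
    using n r by (simp add: sum.remove[of "{..<n}" 0])
  also have "\<dots> = 2 * (1 - r)"
    using u by (simp add: vnorm2_def power2_eq_square algebra_simps)
  finally have "(\<Sum>i<n. (cmod (w i))\<^sup>2) = 2 * (1 - r)" .
  then have nw: "(\<Sum>k<n. cnj (w k) * w k) = complex_of_real (2 * (1 - r))"
    unfolding mult.commute[of "cnj _"] complex_norm_square[symmetric] of_real_sum[symmetric] by (rule arg_cong)
  have aW: "adj W = W" by (rule eq_matI) (auto simp: W_def)
  have "W * W = 1\<^sub>m n"
  proof (rule eq_matI)
    fix i j assume "i < dim_row (1\<^sub>m n :: complex mat)" "j < dim_col (1\<^sub>m n :: complex mat)"
    then have ij: "i < n" "j < n" by auto
    let ?\<delta> = "\<lambda>i j. if i = j then 1 else (0::complex)"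
    have "(W * W) $$ (i, j) = (\<Sum>k<n. W $$ (i, k) * W $$ (k, j))"
      using W ij by (auto simp: scalar_prod_def atLeast0LessThan intro!: sum.cong)
    also have "\<dots> = (\<Sum>k<n. (if i = k then ?\<delta> k j else 0) - (if k = j then a * w i * cnj (w k) else 0)
        - (if i = k then a * w k * cnj (w j) else 0) + a\<^sup>2 * w i * cnj (w j) * (cnj (w k) * w k))"
      using ij by (intro sum.cong) (auto simp: W_def algebra_simps power2_eq_square)
    also have "\<dots> = ?\<delta> i j - 2 * (a * w i * cnj (w j))
        + a\<^sup>2 * w i * cnj (w j) * complex_of_real (2 * (1 - r))"
      using ij by (simp add: sum.distrib sum_subtractf nw flip: sum_distrib_left)
    also have "\<dots> = ?\<delta> i j - 2 * (a * w i * cnj (w j))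
        + 2 * a * w i * cnj (w j) * complex_of_real (a * (1 - r))"
      by (simp add: power2_eq_square algebra_simps)
    also have "\<dots> = ?\<delta> i j" unfolding ar by simp
    finally show "(W * W) $$ (i, j) = 1\<^sub>m n $$ (i, j)" using ij by simp
  qed (use W in auto)
  then have "unitary n W" using W by (simp add: unitary_def aW)
  moreover have "W $$ (i, 0) = u $ i" if "i < n" for i
  proof -
    have "W $$ (i, 0) = (if i = 0 then 1 else 0) + w i * complex_of_real (a * (1 - r))"
      using that n by (simp add: W_def w_def r algebra_simps)
    then show ?thesis unfolding ar by (simp add: w_def)
  qed
  ultimately show ?thesis using aW that by blast
qed

text \<open>The direct sum of a scalar and a matrix: the shape of a Hermitian matrix once one
  eigenvector has been split off.\<close>

definition bdiag :: "complex \<Rightarrow> complex mat \<Rightarrow> complex mat" where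
  "bdiag a M = four_block_mat (a \<cdot>\<^sub>m 1\<^sub>m 1) (0\<^sub>m 1 (dim_col M)) (0\<^sub>m (dim_row M) 1) M"

lemma bdiag_carrier: "M \<in> carrier_mat m m \<Longrightarrow> bdiag a M \<in> carrier_mat (Suc m) (Suc m)"
  by (auto simp: bdiag_def)

lemma bdiag_mult:
  assumes "M \<in> carrier_mat m m" "N \<in> carrier_mat m m"
  shows "bdiag a M * bdiag b N = bdiag (a * b) (M * N)"
  unfolding bdiag_def using assms
  by (subst mult_four_block_mat[of _ 1 1 _ m _ m _ _ 1 _ m]) (auto intro!: cong_four_block_mat eq_matI)

lemma adj_bdiag: "adj (bdiag a M) = bdiag (cnj a) (adj M)"
  by (rule eq_matI) (auto simp: bdiag_def)

lemma bdiag_one: "bdiag 1 (1\<^sub>m m) = 1\<^sub>m (Suc m)"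
  by (rule eq_matI) (auto simp: bdiag_def)

lemma bdiag_rdiag: "bdiag (complex_of_real a) (rdiag m d) = rdiag (Suc m) (case_nat a d)"
  by (rule eq_matI) (auto simp: bdiag_def split: nat.splits)

lemma unitary_bdiag: "unitary m U \<Longrightarrow> unitary (Suc m) (bdiag 1 U)"
  by (auto simp: unitary_def bdiag_carrier adj_bdiag bdiag_mult[of _ m] bdiag_one)

text \<open>The spectrum of a nonempty complex matrix is nonempty, and an eigenvector may be
  rescaled by any nonzero complex number. The modulus of the scalar is spent on the norm, its phase
  on making the first coordinate real, as \<open>householder\<close> requires.\<close>

lemma exists_unit_eigenvector:
  assumes A: "A \<in> carrier_mat (Suc m) (Suc m)"
  obtains u k r where "u \<in> carrier_vec (Suc m)" "vnorm2 u = 1" "A *\<^sub>v u = k \<cdot>\<^sub>v u"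
    "u $ 0 = complex_of_real r"
proof -
  from spectrum_non_empty[OF A] obtain k v
    where v: "v \<in> carrier_vec (Suc m)" "v \<noteq> 0\<^sub>v (Suc m)" "A *\<^sub>v v = k \<cdot>\<^sub>v v"
    using A by (auto simp: spectrum_def eigenvalue_def eigenvector_def)
  define ph where "ph = (if v $ 0 = 0 then 1 else cnj (v $ 0) / cmod (v $ 0))"
  define c where "c = ph / sqrt (vnorm2 v)"
  have pos: "vnorm2 v > 0"
    using v vnorm2_eq_0[of v] vnorm2_nonneg[of v] by (metis carrier_vecD less_eq_real_def)
  have ph: "cmod ph = 1" by (simp add: ph_def norm_divide)
  have "ph * v $ 0 = cmod (v $ 0)"
    using complex_norm_square[of "v $ 0"] by (simp add: ph_def divide_simps power2_eq_square mult.commute)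
  then have "(c \<cdot>\<^sub>v v) $ 0 = complex_of_real (cmod (v $ 0) / sqrt (vnorm2 v))"
    using v(1) by (simp add: c_def)
  moreover have "vnorm2 (c \<cdot>\<^sub>v v) = 1"
    using pos ph by (simp add: vnorm2_smult c_def norm_divide power_divide)
  moreover have "A *\<^sub>v (c \<cdot>\<^sub>v v) = k \<cdot>\<^sub>v (c \<cdot>\<^sub>v v)"
    using mult_mat_vec[OF A v(1), of c] v by (simp add: smult_smult_assoc mult.commute)
  ultimately show ?thesis using v(1) that smult_carrier_vec by metis
qed

lemma spec_decompI:
  assumes "A \<in> carrier_mat n n" "unitary n U" "A = U * rdiag n d * adj U"
  shows "spec_decomp A U d"
proof -
  have "dim_row A = n" using assms(1) by simp
  then show ?thesis unfolding spec_decomp_def using assms by metis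
qed

text \<open>Deflation, by induction on the size: conjugating with a Householder reflection that
  sends the first basis vector to a unit eigenvector clears the first column below the diagonal,
  Hermitian symmetry clears the first row, and the induction hypothesis diagonalizes the remaining
  block.\<close>

theorem hermitian_spec_decomp:
  assumes "A \<in> carrier_mat n n" "adj A = A"
  obtains U d where "spec_decomp A U d"
  using assms
proof (induction n arbitrary: A thesis)
  case 0
  then show ?case
    by (intro "0.prems"(1)[of "1\<^sub>m 0" "\<lambda>_. 0"]) (auto simp: spec_decomp_def unitary_def intro!: eq_matI)
next
  case (Suc m)
  note A = Suc.prems(2,3)
  let ?n = "Suc m"
  from exists_unit_eigenvector[OF A(1)] obtain u k r
    where u: "u \<in> carrier_vec ?n" "vnorm2 u = 1" "A *\<^sub>v u = k \<cdot>\<^sub>v u" "u $ 0 = complex_of_real r"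
    by metis
  from householder[OF u(1,2) _ u(4)] obtain W
    where W: "unitary ?n W" "adj W = W" "\<And>i. i < ?n \<Longrightarrow> W $$ (i, 0) = u $ i" by auto
  have Wc: "W \<in> carrier_mat ?n ?n" using W(1) by (rule unitary_carrier)
  have WW: "W * W = 1\<^sub>m ?n" using W by (simp add: unitary_def)
  define B where "B = W * (A * W)"
  have Bc: "B \<in> carrier_mat ?n ?n" using A Wc by (simp add: B_def)
  have adjB: "adj B = B"
    using A Wc W(2) by (simp add: B_def adj_mult[of _ ?n ?n _ ?n] assoc_mult_mat[of _ ?n ?n _ ?n _ ?n])
  \<comment> \<open>\<open>W\<close> maps the first basis vector to \<open>u\<close>,
    \<open>A\<close> scales \<open>u\<close> by \<open>k\<close>, and the involution
    \<open>W\<close> maps \<open>u\<close> back.\<close>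
  have col0: "B $$ (i, 0) = (if i = 0 then k else 0)" if i: "i < ?n" for i
  proof -
    have cW: "col W 0 = u" using W(3) Wc u(1) by (intro eq_vecI) auto
    have "col B 0 = W *\<^sub>v (A *\<^sub>v col W 0)"
      using A Wc unfolding B_def by (simp add: col_mult2[of _ ?n ?n _ ?n] del: col_mult)
    also have "\<dots> = k \<cdot>\<^sub>v (W *\<^sub>v col W 0)"
      using mult_mat_vec[OF Wc u(1)] u(3) by (simp add: cW)
    also have "\<dots> = k \<cdot>\<^sub>v col (W * W) 0" using col_mult2[OF Wc Wc] by simp
    finally have "col B 0 = k \<cdot>\<^sub>v unit_vec ?n 0" by (simp add: WW)
    then have "col B 0 $ i = (k \<cdot>\<^sub>v unit_vec ?n 0) $ i" by simp
    then show ?thesis using i Bc by simp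
  qed
  have herm: "cnj (B $$ (j, i)) = B $$ (i, j)" if "i < ?n" "j < ?n" for i j
    using index_adj[of i B j] that Bc adjB by auto
  have kr: "k = complex_of_real (Re k)"
    using herm[of 0 0] col0[of 0] by (simp add: complex_eq_iff)
  define B' where "B' = mat m m (\<lambda>(i, j). B $$ (Suc i, Suc j))"
  have "adj B' = B'" by (rule eq_matI) (auto simp: B'_def herm)
  moreover have B'c: "B' \<in> carrier_mat m m" by (simp add: B'_def)
  ultimately obtain U d where "spec_decomp B' U d" using Suc.IH by blast
  then have U: "unitary m U" "B' = U * rdiag m d * adj U" using B'c by (auto simp: spec_decomp_def)
  have Uc: "U \<in> carrier_mat m m" using U(1) by (rule unitary_carrier)
  have "B = bdiag k B'"
  proof (rule eq_matI)
    fix i j assume "i < dim_row (bdiag k B')" "j < dim_col (bdiag k B')"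
    then have ij: "i < ?n" "j < ?n" using bdiag_carrier[OF B'c, of k] by auto
    then show "B $$ (i, j) = bdiag k B' $$ (i, j)"
      using col0[OF ij(1)] col0[OF ij(2)] herm[OF ij] B'c
      by (cases i; cases j) (auto simp: bdiag_def B'_def)
  qed (use Bc bdiag_carrier[OF B'c, of k] in auto)
  also have "\<dots> = bdiag 1 U * bdiag k (rdiag m d) * adj (bdiag 1 U)"
    using Uc by (simp add: U(2) adj_bdiag bdiag_mult[of _ m])
  finally have B: "B = bdiag 1 U * rdiag ?n (case_nat (Re k) d) * adj (bdiag 1 U)"
    using kr bdiag_rdiag[of "Re k" m d] by simp
  define V where "V = bdiag 1 U"
  have Vc: "V \<in> carrier_mat ?n ?n" using Uc bdiag_carrier by (simp add: V_def)
  have "A = W * (B * W)"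
    using A Wc unitary_cancel[OF W(1), unfolded W(2)] WW
    by (simp add: B_def assoc_mult_mat[of _ ?n ?n _ ?n _ ?n])
  also have "\<dots> = (W * V) * rdiag ?n (case_nat (Re k) d) * adj (W * V)"
    using Wc Vc by (simp add: B adj_mult[of _ ?n ?n _ ?n] assoc_mult_mat[of _ ?n ?n _ ?n _ ?n] mult_carrier_mat[of _ ?n ?n _ ?n] W(2) flip: V_def)
  finally have "spec_decomp A (W * V) (case_nat (Re k) d)"
    using A(1) unitary_mult[OF W(1) unitary_bdiag[OF U(1)]] by (intro spec_decompI) (simp_all only: V_def)
  then show ?case by (rule Suc.prems(1))
qed

section \<open>Functional calculus and singular values\<close>

text \<open>Entrywise, the hypothesis says that \<open>W $$ (i, j)\<close> can be nonzero only where
  \<open>d j = d' i\<close>; applying \<open>\<phi>\<close> to both diagonals preserves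
  this.\<close>

lemma rdiag_intertwine:
  assumes W: "W \<in> carrier_mat n n" and eq: "W * rdiag n d = rdiag n d' * W"
  shows "W * rdiag n (\<phi> \<circ> d) = rdiag n (\<phi> \<circ> d') * W"
proof (rule eq_matI)
  fix i j assume "i < dim_row (rdiag n (\<phi> \<circ> d') * W)" "j < dim_col (rdiag n (\<phi> \<circ> d') * W)"
  then have ij: "i < n" "j < n" using W by auto
  have "W $$ (i, j) = 0 \<or> d j = d' i"
    using arg_cong[OF eq, of "\<lambda>M. M $$ (i, j)"] W ij by (simp del: index_mult_mat(1))
  then show "(W * rdiag n (\<phi> \<circ> d)) $$ (i, j) = (rdiag n (\<phi> \<circ> d') * W) $$ (i, j)"
    using W ij by (auto simp del: index_mult_mat(1))
qed (use W in auto)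

lemma spec_decompD:
  assumes "spec_decomp A U d" "A \<in> carrier_mat n n"
  shows "unitary n U" "U \<in> carrier_mat n n" "A = U * rdiag n d * adj U"
  using assms by (auto simp: spec_decomp_def unitary_def)

text \<open>\<open>matfun\<close> picks an arbitrary spectral decomposition, so independence of that
  choice is the point. For two decompositions with unitaries \<open>U\<close> and \<open>V\<close>,
  the change of basis \<open>adj U * V\<close> intertwines the two diagonals, hence also their
  images under \<open>\<phi>\<close>.\<close>

lemma matfun_eq:
  assumes A: "A \<in> carrier_mat n n" and U: "spec_decomp A U d"
  shows "matfun \<phi> A = U * rdiag n (\<phi> \<circ> d) * adj U"
proof -
  have uniq: "V * rdiag n (\<phi> \<circ> d') * adj V = U * rdiag n (\<phi> \<circ> d) * adj U" if V: "spec_decomp A V d'" for V d'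
  proof -
    note u = spec_decompD[OF U A] and v = spec_decompD[OF V A]
    note c = u(2) v(2) A adj_carrier[OF u(2)] adj_carrier[OF v(2)]
      assoc_mult_mat[of _ n n _ n _ n] mult_carrier_mat[of _ n n _ n]
      unitary_cancel[OF u(1), of _ n] unitary_cancel[OF v(1), of _ n]
    have vv: "adj V * V = 1\<^sub>m n" using v(1) by (simp add: unitary_def)
    let ?W = "adj U * V"
    have "?W * rdiag n d' = adj U * (V * rdiag n d' * adj V) * V" using vv by (simp add: c)
    also have "\<dots> = adj U * (U * rdiag n d * adj U) * V" using u(3) v(3) by simp
    also have "\<dots> = rdiag n d * ?W" by (simp add: c)
    finally have "?W * rdiag n (\<phi> \<circ> d') = rdiag n (\<phi> \<circ> d) * ?W"
      using c by (intro rdiag_intertwine) auto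
    then have "U * (?W * rdiag n (\<phi> \<circ> d')) * adj V = U * (rdiag n (\<phi> \<circ> d) * ?W) * adj V" by simp
    moreover have "V * adj V = 1\<^sub>m n" using v(1) by (simp add: unitary_def)
    ultimately show ?thesis by (simp add: c right_mult_one_mat[of _ n n])
  qed
  have "dim_row A = n" using A by simp
  then show ?thesis unfolding matfun_def using U uniq by (intro some_equality) blast+
qed

lemma spec_decomp_matfun:
  assumes A: "A \<in> carrier_mat n n" and U: "spec_decomp A U d"
  shows "matfun \<phi> A \<in> carrier_mat n n" "spec_decomp (matfun \<phi> A) U (\<phi> \<circ> d)"
proof -
  note u = spec_decompD[OF U A]
  show c: "matfun \<phi> A \<in> carrier_mat n n" using u(2) by (simp add: matfun_eq[OF A U] mult_carrier_mat[of _ n n _ n])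
  show "spec_decomp (matfun \<phi> A) U (\<phi> \<circ> d)"
    using c u(1) matfun_eq[OF A U] by (rule spec_decompI)
qed

section \<open>Inner products, Gram matrices and expansions in singular vectors\<close>

lemma cscalar_prod_adj:
  assumes "A \<in> carrier_mat n m" "x \<in> carrier_vec m" "y \<in> carrier_vec n"
  shows "(A *\<^sub>v x) \<bullet>c y = x \<bullet>c (adj A *\<^sub>v y)"
proof -
  have "(A *\<^sub>v x) \<bullet>c y = (\<Sum>i<n. \<Sum>j<m. A $$ (i, j) * x $ j * cnj (y $ i))"
    using assms by (auto simp: scalar_prod_def atLeast0LessThan sum_distrib_right intro!: sum.cong)
  also have "\<dots> = (\<Sum>j<m. \<Sum>i<n. A $$ (i, j) * x $ j * cnj (y $ i))" by (rule sum.swap)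
  also have "\<dots> = x \<bullet>c (adj A *\<^sub>v y)"
    using assms by (auto simp: scalar_prod_def atLeast0LessThan sum_distrib_left intro!: sum.cong)
  finally show ?thesis .
qed

lemma cscalar_prod_Cauchy_Schwarz:
  assumes "x \<in> carrier_vec n" "y \<in> carrier_vec n"
  shows "cmod (x \<bullet>c y) \<le> sqrt (vnorm2 x) * sqrt (vnorm2 y)"
proof -
  have "cmod (x \<bullet>c y) \<le> (\<Sum>i<n. \<bar>cmod (x $ i)\<bar> * \<bar>cmod (y $ i)\<bar>)"
    using assms by (auto simp: scalar_prod_def atLeast0LessThan norm_mult intro!: sum_norm_le)
  also have "\<dots> \<le> sqrt (vnorm2 x) * sqrt (vnorm2 y)"
    using L2_set_mult_ineq[of "\<lambda>i. cmod (x $ i)" "\<lambda>i. cmod (y $ i)" "{..<n}"] assms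
    by (simp add: L2_set_def vnorm2_def)
  finally show ?thesis .
qed

lemma vnorm2_mult_mat_vec:
  assumes "A \<in> carrier_mat n m" "x \<in> carrier_vec m"
  shows "complex_of_real (vnorm2 (A *\<^sub>v x)) = (adj A * A *\<^sub>v x) \<bullet>c x"
proof -
  have "complex_of_real (vnorm2 (A *\<^sub>v x)) = (A *\<^sub>v x) \<bullet>c (A *\<^sub>v x)"
    by (rule cscalar_prod_self[symmetric])
  also have "\<dots> = (A *\<^sub>v x) \<bullet>c (adj (adj A) *\<^sub>v x)" by simp
  also have "\<dots> = (adj A *\<^sub>v (A *\<^sub>v x)) \<bullet>c x"
    using assms by (intro cscalar_prod_adj[symmetric, of _ m n]) auto
  finally show ?thesis using assms by (simp add: assoc_mult_mat_vec[of _ m n _ m])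
qed

lemma vnorm2_unitary:
  assumes "unitary n U" "x \<in> carrier_vec n"
  shows "vnorm2 (U *\<^sub>v x) = vnorm2 x"
  using vnorm2_mult_mat_vec[OF unitary_carrier[OF assms(1)] assms(2)] assms
  by (simp add: unitary_def cscalar_prod_self)

lemma rdiag_mult_vec:
  assumes "x \<in> carrier_vec n" "i < n"
  shows "(rdiag n d *\<^sub>v x) $ i = d i * x $ i"
proof -
  have "(rdiag n d *\<^sub>v x) $ i = (\<Sum>k<n. (if i = k then complex_of_real (d i) else 0) * x $ k)"
    using assms by (auto simp: scalar_prod_def atLeast0LessThan intro!: sum.cong)
  also have "\<dots> = (\<Sum>k<n. if i = k then d i * x $ k else 0)"
    by (rule sum.cong) auto
  finally show ?thesis using assms by simp
qed

lemma vnorm2_rdiag: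
  assumes "x \<in> carrier_vec n"
  shows "vnorm2 (rdiag n d *\<^sub>v x) = (\<Sum>i<n. (d i)\<^sup>2 * (cmod (x $ i))\<^sup>2)"
  using assms by (simp add: vnorm2_def rdiag_mult_vec norm_mult power_mult_distrib del: index_mult_mat_vec)

text \<open>The matrix is the Gram matrix of \<open>rdiag n a * adj U\<close>. The equation also
  shows that the quadratic form is real and nonnegative.\<close>

lemma quadratic_form_rdiag_square:
  assumes U: "U \<in> carrier_mat n n" and x: "x \<in> carrier_vec n"
  shows "(U * rdiag n (\<lambda>i. (a i)\<^sup>2) * adj U *\<^sub>v x) \<bullet>c x = vnorm2 (rdiag n a *\<^sub>v (adj U *\<^sub>v x))"
proof -
  have sq: "rdiag n (\<lambda>i. (a i)\<^sup>2) = rdiag n a * rdiag n a"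
    by (simp add: rdiag_mult_rdiag power2_eq_square)
  have "U * rdiag n (\<lambda>i. (a i)\<^sup>2) * adj U = adj (rdiag n a * adj U) * (rdiag n a * adj U)"
    using U unfolding sq
    by (simp add: adj_mult[of _ n n _ n] assoc_mult_mat[of _ n n _ n _ n] mult_carrier_mat[of _ n n _ n])
  moreover have "rdiag n a * adj U *\<^sub>v x = rdiag n a *\<^sub>v (adj U *\<^sub>v x)"
    using U x by (simp add: assoc_mult_mat_vec[of _ n n _ n])
  ultimately show ?thesis
    using vnorm2_mult_mat_vec[of "rdiag n a * adj U" n n x] mult_carrier_mat[OF rdiag_carrier adj_carrier[OF U]] x
    by simp
qed

text \<open>A diagonal entry of a Gram matrix is the squared norm of a column. This yields
  nonnegative eigenvalues below, and later the vanishing of columns that belong to the eigenvalue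
  0.\<close>

lemma gram_diagonal:
  assumes A: "A \<in> carrier_mat n n" and eq: "adj A * A = rdiag n d" and j: "j < n"
  shows "(\<Sum>i<n. (cmod (A $$ (i, j)))\<^sup>2) = d j"
proof -
  have "complex_of_real (\<Sum>i<n. (cmod (A $$ (i, j)))\<^sup>2) = (adj A * A) $$ (j, j)"
    using A j by (auto simp: scalar_prod_def atLeast0LessThan complex_norm_square mult.commute
      simp del: of_real_power intro!: sum.cong)
  also have "\<dots> = complex_of_real (d j)" using j by (simp add: eq)
  finally show ?thesis using of_real_eq_iff by blast
qed

lemma gram_spec_decomp:
  assumes A: "A \<in> carrier_mat n n"
  obtains U s where "unitary n U" "\<And>j. 0 \<le> s j"
    "adj A * A = U * rdiag n (\<lambda>i. (s i)\<^sup>2) * adj U"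
    "spec_decomp (mabs A) U s" "mabs A \<in> carrier_mat n n"
proof -
  have AA: "adj A * A \<in> carrier_mat n n" "adj (adj A * A) = adj A * A"
    using A by (auto simp: adj_mult[of _ n n _ n])
  from hermitian_spec_decomp[OF AA] obtain U d where sd: "spec_decomp (adj A * A) U d" by metis
  note u = spec_decompD[OF sd AA(1)]
  note c = A u(2) adj_carrier[OF A] adj_carrier[OF u(2)] assoc_mult_mat[of _ n n _ n _ n] mult_carrier_mat[of _ n n _ n]
      unitary_cancel[OF u(1), of _ n]
  have UU: "adj U * U = 1\<^sub>m n" using u(1) by (simp add: unitary_def)
  have "adj (A * U) * (A * U) = adj U * (adj A * A) * U"
    by (simp add: c adj_mult[of _ n n _ n])
  also have "\<dots> = rdiag n d"
    unfolding u(3) using UU by (simp add: c)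
  finally have gram: "adj (A * U) * (A * U) = rdiag n d" .
  have "0 \<le> d j" if "j < n" for j
    unfolding gram_diagonal[OF mult_carrier_mat[OF A u(2)] gram that, symmetric]
    by (simp add: sum_nonneg)
  \<comment> \<open>Only the values of \<open>d\<close> below \<open>n\<close> are known to be
    nonnegative. The absolute value leaves the matrices unchanged and makes the resulting
    \<open>s\<close> nonnegative at every index.\<close>
  then have d: "rdiag n d = rdiag n (\<lambda>i. (sqrt \<bar>d i\<bar>)\<^sup>2)" "rdiag n (sqrt \<circ> d) = rdiag n (\<lambda>i. sqrt \<bar>d i\<bar>)"
    by (auto intro!: eq_matI)
  note m = spec_decomp_matfun[OF AA(1) sd, of sqrt, folded mabs_def]
  have "spec_decomp (mabs A) U (\<lambda>i. sqrt \<bar>d i\<bar>)"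
    using m(1) u(1) spec_decompD(3)[OF m(2,1)] unfolding d(2) by (rule spec_decompI)
  then show ?thesis using u(1) u(3)[unfolded d(1)] m(1) by (intro that[of U "\<lambda>i. sqrt \<bar>d i\<bar>"]) simp_all
qed

text \<open>\<open>sing_vals\<close> is an arbitrary choice of eigenvalues of \<open>mabs A\<close>,
  with no order prescribed. What is recovered from the choice is nonnegativity and an orthonormal
  basis that diagonalizes the squared norm of \<open>A *\<^sub>v x\<close>; the columns of
  \<open>U\<close> are right singular vectors.\<close>

lemma sing_vals_expansion:
  assumes A: "A \<in> carrier_mat n n"
  obtains U where "unitary n U" "\<And>j. j < n \<Longrightarrow> 0 \<le> sing_vals A j"
    "\<And>x. x \<in> carrier_vec n \<Longrightarrow>
      vnorm2 (A *\<^sub>v x) = (\<Sum>j<n. (sing_vals A j)\<^sup>2 * (cmod ((adj U *\<^sub>v x) $ j))\<^sup>2)"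
proof -
  from gram_spec_decomp[OF A] obtain V r where V: "unitary n V" "\<And>j. 0 \<le> r j"
    "adj A * A = V * rdiag n (\<lambda>i. (r i)\<^sup>2) * adj V" "spec_decomp (mabs A) V r" "mabs A \<in> carrier_mat n n"
    by metis
  define s where "s = sing_vals A"
  have "\<exists>U. spec_decomp (mabs A) U s"
    unfolding s_def sing_vals_def by (rule someI[of _ r]) (use V(4) in auto)
  then obtain U where U: "spec_decomp (mabs A) U s" by blast
  note u = spec_decompD[OF U V(5)] and v = spec_decompD[OF V(4,5)]
  note c = u(2) v(2) adj_carrier[OF u(2)] adj_carrier[OF v(2)]
    assoc_mult_mat[of _ n n _ n _ n] mult_carrier_mat[of _ n n _ n]
    unitary_cancel[OF u(1), of _ n] unitary_cancel[OF v(1), of _ n]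
  \<comment> \<open>The decomposition with \<open>r\<close> has nonnegative eigenvalues, so
    \<open>abs\<close> fixes \<open>mabs A\<close>. Evaluating the same function through the chosen
    \<open>s\<close> forces \<open>s\<close> to equal its absolute value below
    \<open>n\<close>.\<close>
  have "matfun abs (mabs A) = mabs A"
    using V(2) by (simp add: matfun_eq[OF V(5,4)] comp_def v(3)[symmetric])
  then have "U * rdiag n (abs \<circ> s) * adj U = U * rdiag n s * adj U"
    by (simp only: matfun_eq[OF V(5) U] u(3)[symmetric])
  then have "adj U * (U * rdiag n (abs \<circ> s) * adj U) * U = adj U * (U * rdiag n s * adj U) * U" by simp
  moreover have "adj U * U = 1\<^sub>m n" using u(1) by (simp add: unitary_def)
  ultimately have eq: "rdiag n (abs \<circ> s) = rdiag n s" by (simp add: c)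
  have nonneg: "0 \<le> s j" if "j < n" for j
    using arg_cong[OF eq, of "\<lambda>M. M $$ (j, j)"] that by simp
  have "adj A * A = matfun power2 (mabs A)"
    using V(3) by (simp add: matfun_eq[OF V(5,4)] comp_def)
  also have "\<dots> = U * rdiag n (\<lambda>i. (s i)\<^sup>2) * adj U"
    by (simp add: matfun_eq[OF V(5) U] comp_def)
  finally have gram: "adj A * A = U * rdiag n (\<lambda>i. (s i)\<^sup>2) * adj U" .
  have "vnorm2 (A *\<^sub>v x) = (\<Sum>j<n. (s j)\<^sup>2 * (cmod ((adj U *\<^sub>v x) $ j))\<^sup>2)" if x: "x \<in> carrier_vec n" for x
  proof -
    have "complex_of_real (vnorm2 (A *\<^sub>v x)) = vnorm2 (rdiag n s *\<^sub>v (adj U *\<^sub>v x))"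
      using vnorm2_mult_mat_vec[OF A x] quadratic_form_rdiag_square[OF u(2) x] by (simp add: gram)
    then have "vnorm2 (A *\<^sub>v x) = vnorm2 (rdiag n s *\<^sub>v (adj U *\<^sub>v x))"
      by (simp only: of_real_eq_iff)
    then show ?thesis by (simp only: vnorm2_rdiag[OF mult_mat_vec_carrier[OF c(3) x]])
  qed
  then show ?thesis using u(1) nonneg unfolding s_def by (intro that[of U])
qed

text \<open>Every singular value is at most the maximum, which bounds the norm of
  \<open>A *\<^sub>v x\<close>; Cauchy-Schwarz then bounds the form. Positive \<open>n\<close> makes
  the maximum range over a nonempty set.\<close>

lemma quadratic_form_le_op_norm:
  assumes A: "A \<in> carrier_mat n n" and x: "x \<in> carrier_vec n" and n: "0 < n"
  shows "0 \<le> op_norm A" "Re ((A *\<^sub>v x) \<bullet>c x) \<le> op_norm A * vnorm2 x"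
proof -
  from sing_vals_expansion[OF A] obtain U where U: "unitary n U" "\<And>j. j < n \<Longrightarrow> 0 \<le> sing_vals A j"
    "\<And>x. x \<in> carrier_vec n \<Longrightarrow>
      vnorm2 (A *\<^sub>v x) = (\<Sum>j<n. (sing_vals A j)\<^sup>2 * (cmod ((adj U *\<^sub>v x) $ j))\<^sup>2)" by metis
  have le: "sing_vals A j \<le> op_norm A" if "j < n" for j
    unfolding op_norm_def using that A by (intro Max_ge) auto
  show nonneg: "0 \<le> op_norm A" using U(2)[OF n] le[OF n] by linarith
  have "vnorm2 (A *\<^sub>v x) \<le> (\<Sum>j<n. (op_norm A)\<^sup>2 * (cmod ((adj U *\<^sub>v x) $ j))\<^sup>2)"
    unfolding U(3)[OF x] using U(2) le by (intro sum_mono mult_right_mono power_mono) auto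
  also have "\<dots> = (op_norm A)\<^sup>2 * vnorm2 (adj U *\<^sub>v x)"
    using unitary_carrier[OF U(1)] by (simp add: vnorm2_def sum_distrib_left del: index_mult_mat_vec)
  also have "\<dots> = (op_norm A)\<^sup>2 * vnorm2 x" by (simp add: vnorm2_unitary[OF unitary_adj[OF U(1)] x])
  finally have Ax: "sqrt (vnorm2 (A *\<^sub>v x)) \<le> op_norm A * sqrt (vnorm2 x)"
    using real_sqrt_le_mono[of "vnorm2 (A *\<^sub>v x)" "(op_norm A)\<^sup>2 * vnorm2 x"] nonneg by (simp add: real_sqrt_mult)
  have "Re ((A *\<^sub>v x) \<bullet>c x) \<le> sqrt (vnorm2 (A *\<^sub>v x)) * sqrt (vnorm2 x)"
    using cscalar_prod_Cauchy_Schwarz[of "A *\<^sub>v x" n x] complex_Re_le_cmod[of "(A *\<^sub>v x) \<bullet>c x"] A x by auto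
  also have "\<dots> \<le> op_norm A * sqrt (vnorm2 x) * sqrt (vnorm2 x)" by (rule mult_right_mono[OF Ax]) simp
  finally show "Re ((A *\<^sub>v x) \<bullet>c x) \<le> op_norm A * vnorm2 x" by (simp add: mult.assoc)
qed

section \<open>Weyl monotonicity\<close>

text \<open>Gaussian elimination, by induction on the equations. An equation with zero coefficients
  is dropped; otherwise a pivot removes one equation and one unknown, so the strict inequality of
  the counts persists.\<close>

lemma underdetermined_system:
  fixes M :: "'j \<Rightarrow> 'i \<Rightarrow> 'a::field"
  assumes "finite J" "finite I" "card J < card I"
  obtains c where "\<exists>i\<in>I. c i \<noteq> 0" "\<And>i. i \<notin> I \<Longrightarrow> c i = 0" "\<And>j. j \<in> J \<Longrightarrow> (\<Sum>i\<in>I. M j i * c i) = 0"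
  using assms
proof (induction J arbitrary: I M thesis rule: finite_induct)
  case empty
  then obtain k where "k \<in> I" by fastforce
  then show ?case by (intro empty(1)[of "\<lambda>i. if i = k then 1 else 0"]) auto
next
  case (insert j J)
  show ?case
  proof (cases "\<forall>i\<in>I. M j i = 0")
    case True
    have "card J < card I" using insert by simp
    then obtain c where "\<exists>i\<in>I. c i \<noteq> 0" "\<And>i. i \<notin> I \<Longrightarrow> c i = 0" "\<And>j. j \<in> J \<Longrightarrow> (\<Sum>i\<in>I. M j i * c i) = 0"
      using insert.IH[of I M] insert.prems(2) by metis
    then show ?thesis using True by (intro insert.prems(1)[of c]) auto
  next
    case False
    then obtain k where k: "k \<in> I" "M j k \<noteq> 0" by blast
    let ?I = "I - {k}"
    have "card J < card ?I" using insert.hyps insert.prems k by simp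
    then obtain c where c: "\<exists>i\<in>?I. c i \<noteq> 0" "\<And>i. i \<notin> ?I \<Longrightarrow> c i = 0"
      "\<And>l. l \<in> J \<Longrightarrow> (\<Sum>i\<in>?I. (M l i - M l k * M j i / M j k) * c i) = 0"
      using insert.IH[of ?I "\<lambda>l i. M l i - M l k * M j i / M j k"] insert.prems(2) by auto
    \<comment> \<open>The value that the pivot equation \<open>j\<close> forces on the eliminated
      unknown \<open>k\<close>.\<close>
    define b where "b = - (\<Sum>i\<in>?I. M j i * c i) / M j k"
    have split: "(\<Sum>i\<in>I. M l i * (c(k := b)) i) = M l k * b + (\<Sum>i\<in>?I. M l i * c i)" for l
      using insert.prems(2) k by (subst sum.remove[of _ k]) (auto intro!: sum.cong)
    have "(\<Sum>i\<in>I. M l i * (c(k := b)) i) = 0" if "l \<in> insert j J" for l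
    proof (cases "l = j")
      case True
      then show ?thesis unfolding split using k by (simp add: b_def)
    next
      case False
      have "(\<Sum>i\<in>?I. M l i * c i) - M l k / M j k * (\<Sum>i\<in>?I. M j i * c i) = 0"
        using c(3)[of l] False that by (simp add: algebra_simps sum_subtractf sum_distrib_left)
      then show ?thesis unfolding split by (simp add: b_def)
    qed
    moreover have "\<exists>i\<in>I. (c(k := b)) i \<noteq> 0" using c(1) by auto
    moreover have "(c(k := b)) i = 0" if "i \<notin> I" for i using c(2) that k by auto
    ultimately show ?thesis by (intro insert.prems(1))
  qed
qed

lemma obtain_arg_max:
  fixes a :: "'i \<Rightarrow> real"
  assumes "finite I" "I \<noteq> {}"
  obtains k where "k \<in> I" "\<And>i. i \<in> I \<Longrightarrow> a i \<le> a k"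
proof -
  have "Max (a ` I) \<in> a ` I" using assms by (intro Max_in) auto
  then obtain k where "k \<in> I" "Max (a ` I) = a k" by auto
  then show ?thesis using assms(1) by (intro that[of k]) (auto simp flip: \<open>Max (a ` I) = a k\<close>)
qed

text \<open>Matching the largest values with each other and removing them preserves the
  hypothesis on the counting functions.\<close>

lemma sum_mono_of_counting:
  fixes a :: "'i \<Rightarrow> real" and b :: "'j \<Rightarrow> real" and \<phi> :: "real \<Rightarrow> real"
  assumes "finite I" "finite J"
    and "\<And>t. 0 \<le> t \<Longrightarrow> card {i\<in>I. t < a i} \<le> card {j\<in>J. t < b j}"
    and "\<And>i. i \<in> I \<Longrightarrow> 0 \<le> a i" "\<And>j. j \<in> J \<Longrightarrow> 0 \<le> b j"
    and mono: "\<And>x y. 0 \<le> x \<Longrightarrow> x \<le> y \<Longrightarrow> \<phi> x \<le> \<phi> y" and zero: "\<phi> 0 = 0"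
  shows "(\<Sum>i\<in>I. \<phi> (a i)) \<le> (\<Sum>j\<in>J. \<phi> (b j))"
  using assms(1-5)
proof (induction "card I" arbitrary: I J)
  case 0
  then show ?case using mono[of 0] zero by (auto intro!: sum_nonneg)
next
  case (Suc m)
  note fin = Suc.prems(1,2) and cnt = Suc.prems(3) and nonneg = Suc.prems(4,5)
  have pos: "0 \<le> (\<Sum>j\<in>J. \<phi> (b j))" using nonneg(2) mono[of 0] zero by (auto intro!: sum_nonneg)
  have "I \<noteq> {}" using Suc.hyps(2) by auto
  then obtain k where k: "k \<in> I" "\<And>i. i \<in> I \<Longrightarrow> a i \<le> a k"
    using fin(1) obtain_arg_max by metis
  show ?case
  proof (cases "a k = 0")
    case True
    then have "\<phi> (a i) = 0" if "i \<in> I" for i using k(2)[OF that] nonneg(1)[OF that] zero by (metis order_antisym)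
    then show ?thesis using pos by simp
  next
    case False
    then have ak: "0 < a k" using nonneg(1)[OF k(1)] by simp
    have gt: "\<exists>j\<in>J. t < b j" if "0 \<le> t" "t < a k" for t
    proof -
      have "0 < card {i\<in>I. t < a i}" using fin(1) k(1) that(2) by (subst card_gt_0_iff) auto
      then have "0 < card {j\<in>J. t < b j}" using cnt[OF that(1)] by linarith
      then show ?thesis by (subst (asm) card_gt_0_iff) auto
    qed
    have "J \<noteq> {}" using gt[of 0] ak by auto
    then obtain l where l: "l \<in> J" "\<And>j. j \<in> J \<Longrightarrow> b j \<le> b l"
      using fin(2) obtain_arg_max by metis
    \<comment> \<open>If the maximum \<open>b l\<close> were below \<open>a k\<close>, the threshold
      \<open>b l\<close> in \<open>gt\<close> would produce a still larger value of
      \<open>b\<close>.\<close>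
    have kl: "a k \<le> b l"
      using gt[of "b l"] l(2) nonneg(2)[OF l(1)] by fastforce
    have "(\<Sum>i\<in>I - {k}. \<phi> (a i)) \<le> (\<Sum>j\<in>J - {l}. \<phi> (b j))"
    proof (rule Suc.hyps(1))
      fix t :: real assume t: "0 \<le> t"
      show "card {i\<in>I - {k}. t < a i} \<le> card {j\<in>J - {l}. t < b j}"
      \<comment> \<open>Below \<open>a k\<close>, which is at most \<open>b l\<close>, both sets
        lose exactly one element. From \<open>a k\<close> on, the left set is empty because
        \<open>a k\<close> is the maximum.\<close>
      proof (cases "t < a k")
        case True
        have "{i\<in>I - {k}. t < a i} = {i\<in>I. t < a i} - {k}" "{j\<in>J - {l}. t < b j} = {j\<in>J. t < b j} - {l}"
          by auto
        then show ?thesis using cnt[OF t] True kl k(1) l(1) fin by simp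
      next
        case False
        then have "{i\<in>I - {k}. t < a i} = {}" using k(2) by fastforce
        then show ?thesis by (simp only: card.empty)
      qed
    qed (use Suc.hyps(2) k l fin nonneg in auto)
    moreover have "\<phi> (a k) \<le> \<phi> (b l)" using mono[of "a k" "b l"] ak kl by simp
    ultimately show ?thesis 
      by (simp only: sum.remove[OF fin(1) k(1)] sum.remove[OF fin(2) l(1)] add_mono)
  qed
qed

text \<open>If the count on the left were larger, some nonzero vector would lie in the span of the
  right singular vectors of \<open>Q\<close> counted on the left and be orthogonal to those of \<open>B\<close> counted
  on the right.\<close>

lemma card_sing_vals_le:
  assumes Q: "Q \<in> carrier_mat n n" and B: "B \<in> carrier_mat n n" and "0 \<le> \<kappa>" "0 \<le> t"
    and le: "\<And>x. x \<in> carrier_vec n \<Longrightarrow> vnorm2 (Q *\<^sub>v x) \<le> \<kappa> * Re ((B *\<^sub>v x) \<bullet>c x)"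
  shows "card {j\<in>{..<n}. \<kappa> * t < (sing_vals Q j)\<^sup>2} \<le> card {j\<in>{..<n}. t < sing_vals B j}"
    (is "card ?I \<le> card ?J")
proof (rule ccontr)
  assume "\<not> card ?I \<le> card ?J"
  then have less: "card ?J < card ?I" by simp
  from sing_vals_expansion[OF Q] obtain U where U: "unitary n U" "\<And>j. j < n \<Longrightarrow> 0 \<le> sing_vals Q j"
    "\<And>x. x \<in> carrier_vec n \<Longrightarrow>
      vnorm2 (Q *\<^sub>v x) = (\<Sum>j<n. (sing_vals Q j)\<^sup>2 * (cmod ((adj U *\<^sub>v x) $ j))\<^sup>2)" by metis
  from sing_vals_expansion[OF B] obtain V where V: "unitary n V" "\<And>j. j < n \<Longrightarrow> 0 \<le> sing_vals B j"
    "\<And>x. x \<in> carrier_vec n \<Longrightarrow>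
      vnorm2 (B *\<^sub>v x) = (\<Sum>j<n. (sing_vals B j)\<^sup>2 * (cmod ((adj V *\<^sub>v x) $ j))\<^sup>2)" by metis
  note Uc = unitary_carrier[OF U(1)] and Vc = unitary_carrier[OF V(1)]
  obtain c where c: "\<exists>i\<in>?I. c i \<noteq> 0" "\<And>i. i \<notin> ?I \<Longrightarrow> c i = 0"
    "\<And>j. j \<in> ?J \<Longrightarrow> (\<Sum>i\<in>?I. (adj V * U) $$ (j, i) * c i) = 0"
    using underdetermined_system[OF _ _ less, of "\<lambda>j i. (adj V * U) $$ (j, i)"] by auto
  define y where "y = vec n c"
  define x where "x = U *\<^sub>v y"
  have y: "y \<in> carrier_vec n" by (simp add: y_def)
  have x: "x \<in> carrier_vec n" using Uc y by (simp add: x_def)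
  have nx: "vnorm2 x = vnorm2 y" unfolding x_def by (rule vnorm2_unitary[OF U(1) y])
  have "adj U *\<^sub>v x = adj U * U *\<^sub>v y"
    unfolding x_def using Uc y by (intro assoc_mult_mat_vec[symmetric]) auto
  then have Ux: "adj U *\<^sub>v x = y" using U(1) y by (simp add: unitary_def)
  have Vx: "(adj V *\<^sub>v x) $ j = 0" if "j \<in> ?J" for j
  proof -
    have "adj V *\<^sub>v x = adj V * U *\<^sub>v y"
      unfolding x_def using Uc Vc y by (intro assoc_mult_mat_vec[symmetric]) auto
    then have "(adj V *\<^sub>v x) $ j = (\<Sum>i<n. (adj V * U) $$ (j, i) * c i)"
      using that Uc Vc by (simp add: scalar_prod_def[of "row _ _"] atLeast0LessThan y_def del: index_mult_mat(1))
    also have "\<dots> = (\<Sum>i\<in>?I. (adj V * U) $$ (j, i) * c i)"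
      using c(2) by (intro sum.mono_neutral_right) auto
    finally show ?thesis using c(3)[OF that] by simp
  qed
  \<comment> \<open>Coordinates of \<open>x\<close> along right singular vectors in
    \<open>?J\<close> vanish; the remaining singular values of \<open>B\<close> are at most
    \<open>t\<close>.\<close>
  have "vnorm2 (B *\<^sub>v x) \<le> (\<Sum>j<n. t\<^sup>2 * (cmod ((adj V *\<^sub>v x) $ j))\<^sup>2)"
    unfolding V(3)[OF x]
  proof (rule sum_mono)
    fix j assume j: "j \<in> {..<n}"
    show "(sing_vals B j)\<^sup>2 * (cmod ((adj V *\<^sub>v x) $ j))\<^sup>2 \<le> t\<^sup>2 * (cmod ((adj V *\<^sub>v x) $ j))\<^sup>2"
    proof (cases "j \<in> ?J")
      case True
      then show ?thesis by (simp add: Vx)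
    next
      case False
      then have "(sing_vals B j)\<^sup>2 \<le> t\<^sup>2" using j V(2)[of j] by (intro power_mono) auto
      then show ?thesis by (rule mult_right_mono) simp
    qed
  qed
  also have "\<dots> = t\<^sup>2 * vnorm2 (adj V *\<^sub>v x)"
    using Vc by (simp add: vnorm2_def sum_distrib_left del: index_mult_mat_vec)
  also have "\<dots> = t\<^sup>2 * vnorm2 x" by (simp add: vnorm2_unitary[OF unitary_adj[OF V(1)] x])
  finally have Bx: "sqrt (vnorm2 (B *\<^sub>v x)) \<le> t * sqrt (vnorm2 x)"
    using real_sqrt_le_mono[of "vnorm2 (B *\<^sub>v x)" "t\<^sup>2 * vnorm2 x"] \<open>0 \<le> t\<close> by (simp add: real_sqrt_mult)
  \<comment> \<open>Cauchy-Schwarz links the quadratic form in \<open>le\<close> to the singular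
    values of \<open>B\<close>.\<close>
  have "Re ((B *\<^sub>v x) \<bullet>c x) \<le> sqrt (vnorm2 (B *\<^sub>v x)) * sqrt (vnorm2 x)"
    using cscalar_prod_Cauchy_Schwarz[of "B *\<^sub>v x" n x] complex_Re_le_cmod[of "(B *\<^sub>v x) \<bullet>c x"] B x by auto
  also have "\<dots> \<le> t * sqrt (vnorm2 x) * sqrt (vnorm2 x)" by (rule mult_right_mono[OF Bx]) simp
  also have "\<dots> = t * vnorm2 x" by (simp add: mult.assoc)
  finally have "vnorm2 (Q *\<^sub>v x) \<le> \<kappa> * (t * vnorm2 y)"
    using le[OF x] mult_left_mono[OF _ \<open>0 \<le> \<kappa>\<close>, of "Re ((B *\<^sub>v x) \<bullet>c x)" "t * vnorm2 x"] nx by simp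
  \<comment> \<open>Only indices in \<open>?I\<close> contribute to \<open>y\<close>, each with
    squared singular value above \<open>\<kappa> * t\<close>. Strictness comes from a nonzero
    coefficient of \<open>c\<close>.\<close>
  moreover have "\<kappa> * (t * vnorm2 y) < vnorm2 (Q *\<^sub>v x)"
  proof -
    have "\<kappa> * (t * vnorm2 y) = (\<Sum>j<n. \<kappa> * t * (cmod (c j))\<^sup>2)"
      by (simp add: vnorm2_def y_def sum_distrib_left mult.assoc)
    also have "\<dots> < (\<Sum>j<n. (sing_vals Q j)\<^sup>2 * (cmod (c j))\<^sup>2)"
    proof (rule sum_strict_mono_ex1)
      show "\<forall>j\<in>{..<n}. \<kappa> * t * (cmod (c j))\<^sup>2 \<le> (sing_vals Q j)\<^sup>2 * (cmod (c j))\<^sup>2"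
      proof
        fix j assume "j \<in> {..<n}"
        then show "\<kappa> * t * (cmod (c j))\<^sup>2 \<le> (sing_vals Q j)\<^sup>2 * (cmod (c j))\<^sup>2"
          using c(2)[of j] by (cases "j \<in> ?I") (auto intro!: mult_right_mono)
      qed
      show "\<exists>j\<in>{..<n}. \<kappa> * t * (cmod (c j))\<^sup>2 < (sing_vals Q j)\<^sup>2 * (cmod (c j))\<^sup>2"
      proof -
        obtain i where i: "i \<in> ?I" "c i \<noteq> 0" using c(1) by blast
        then have "\<kappa> * t * (cmod (c i))\<^sup>2 < (sing_vals Q i)\<^sup>2 * (cmod (c i))\<^sup>2"
          by (intro mult_strict_right_mono) auto
        then show ?thesis using i(1) by blast
      qed
    qed simp
    also have "\<dots> = vnorm2 (Q *\<^sub>v x)" unfolding U(3)[OF x] Ux by (simp add: y_def)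
    finally show ?thesis .
  qed
  ultimately show False by simp
qed

section \<open>The mixed Schwarz inequality\<close>

lemma mixed_schwarz_diagonal:
  assumes W: "W \<in> carrier_mat n n"
    and WW: "adj W * W = rdiag n (\<lambda>i. (\<delta> i)\<^sup>2)" "W * adj W = rdiag n (\<lambda>i. (\<epsilon> i)\<^sup>2)"
    and nonneg: "\<And>i. 0 \<le> \<delta> i" "\<And>i. 0 \<le> \<epsilon> i"
    and fg: "\<And>t. 0 \<le> t \<Longrightarrow> f t * g t = t"
    and x: "x \<in> carrier_vec n" and y: "y \<in> carrier_vec n"
  shows "cmod ((W *\<^sub>v x) \<bullet>c y)
    \<le> sqrt (vnorm2 (rdiag n (f \<circ> \<delta>) *\<^sub>v x)) * sqrt (vnorm2 (rdiag n (g \<circ> \<epsilon>) *\<^sub>v y))"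
proof -
  \<comment> \<open>\<open>W = g(\<epsilon>) K f(\<delta>)\<close> with the partial isometry \<open>K\<close>, because \<open>\<epsilon> i = \<delta> j\<close> wherever \<open>W $$ (i, j) \<noteq> 0\<close>;
    columns with \<open>\<delta> j = 0\<close> vanish in \<open>W\<close>, and in \<open>K\<close> since \<open>1 / 0 = 0\<close>.\<close>
  define K where "K = W * rdiag n (\<lambda>i. 1 / \<delta> i)"
  note c = W adj_carrier[OF W] assoc_mult_mat[of _ n n _ n _ n] mult_carrier_mat[of _ n n _ n]
  have K: "K \<in> carrier_mat n n" by (simp add: K_def c)
  have eq: "\<epsilon> i = \<delta> j" if "i < n" "j < n" "W $$ (i, j) \<noteq> 0" for i j
  proof -
    \<comment> \<open>Comparing the two bracketings entry by entry lets each nonzero entry of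
      \<open>W\<close> identify an eigenvalue of one Gram matrix with one of the other.\<close>
    have "W * (adj W * W) = W * adj W * W" by (simp add: c)
    then have "(W * rdiag n (\<lambda>i. (\<delta> i)\<^sup>2)) $$ (i, j) = (rdiag n (\<lambda>i. (\<epsilon> i)\<^sup>2) * W) $$ (i, j)"
      by (simp only: WW)
    then have "W $$ (i, j) * complex_of_real ((\<delta> j)\<^sup>2) = complex_of_real ((\<epsilon> i)\<^sup>2) * W $$ (i, j)"
      using that W by (simp only: index_rdiag_mult index_mult_rdiag)
    then have "complex_of_real ((\<delta> j)\<^sup>2) = complex_of_real ((\<epsilon> i)\<^sup>2)" using that(3) by simp
    then have "(\<delta> j)\<^sup>2 = (\<epsilon> i)\<^sup>2" by (simp only: of_real_eq_iff)
    then show ?thesis using nonneg by (metis power2_eq_imp_eq)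
  qed
  have zero: "W $$ (i, j) = 0" if "i < n" "j < n" "\<delta> j = 0" for i j
  proof -
    have "(\<Sum>i<n. (cmod (W $$ (i, j)))\<^sup>2) = 0"
      using gram_diagonal[OF W WW(1) that(2)] that(3) by simp
    then show ?thesis using that(1) by (subst (asm) sum_nonneg_eq_0_iff) auto
  qed
  have fac: "W = rdiag n (g \<circ> \<epsilon>) * (K * rdiag n (f \<circ> \<delta>))"
  proof (rule eq_matI)
    fix i j assume "i < dim_row (rdiag n (g \<circ> \<epsilon>) * (K * rdiag n (f \<circ> \<delta>)))"
      "j < dim_col (rdiag n (g \<circ> \<epsilon>) * (K * rdiag n (f \<circ> \<delta>)))"
    then have ij: "i < n" "j < n" by auto
    have "(rdiag n (g \<circ> \<epsilon>) * (K * rdiag n (f \<circ> \<delta>))) $$ (i, j)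
        = g (\<epsilon> i) * (W $$ (i, j) * complex_of_real (1 / \<delta> j) * f (\<delta> j))"
      using ij K W unfolding comp_def
      by (simp only: index_rdiag_mult[of _ n n] index_mult_rdiag[of _ n n] K_def mult_carrier_mat[of _ n n _ n] rdiag_carrier)
    also have "\<dots> = W $$ (i, j)"
    proof (cases "W $$ (i, j) = 0")
      case False
      then have "\<delta> j \<noteq> 0" "\<epsilon> i = \<delta> j" using zero eq ij by auto
      then have "g (\<epsilon> i) * (W $$ (i, j) * complex_of_real (1 / \<delta> j) * f (\<delta> j))
          = W $$ (i, j) * complex_of_real (f (\<delta> j) * g (\<delta> j) / \<delta> j)" by simp
      then show ?thesis using fg[OF nonneg(1)[of j]] \<open>\<delta> j \<noteq> 0\<close> by simp
    qed simp
    finally show "W $$ (i, j) = (rdiag n (g \<circ> \<epsilon>) * (K * rdiag n (f \<circ> \<delta>))) $$ (i, j)" by simp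
  qed (use W in auto)
  have contr: "vnorm2 (K *\<^sub>v z) \<le> vnorm2 z" if z: "z \<in> carrier_vec n" for z
  proof -
    \<comment> \<open>\<open>adj K * K\<close> has diagonal entries 1 where \<open>\<delta>\<close>
      is nonzero and 0 elsewhere: it is the coordinate projection with diagonal \<open>a\<close>, so
      \<open>K\<close> is a contraction.\<close>
    define a where "a i = (if \<delta> i = 0 then 0 else 1::real)" for i
    have "adj K * K = rdiag n (\<lambda>i. 1 / \<delta> i) * (adj W * W) * rdiag n (\<lambda>i. 1 / \<delta> i)"
      by (simp add: K_def adj_mult[of _ n n _ n] c)
    also have "\<dots> = 1\<^sub>m n * rdiag n (\<lambda>i. (a i)\<^sup>2) * adj (1\<^sub>m n)"
      unfolding WW rdiag_mult_rdiag
      by (auto intro!: eq_matI simp: a_def power2_eq_square)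
    finally have "complex_of_real (vnorm2 (K *\<^sub>v z)) = vnorm2 (rdiag n a *\<^sub>v z)"
      using vnorm2_mult_mat_vec[OF K z] quadratic_form_rdiag_square[OF one_carrier_mat z, of a] z by simp
    then have "vnorm2 (K *\<^sub>v z) = vnorm2 (rdiag n a *\<^sub>v z)" by (simp only: of_real_eq_iff)
    also have "\<dots> \<le> vnorm2 z"
      unfolding vnorm2_rdiag[OF z] using z by (auto simp: vnorm2_def a_def intro!: sum_mono)
    finally show ?thesis .
  qed
  define u where "u = rdiag n (f \<circ> \<delta>) *\<^sub>v x"
  have u: "u \<in> carrier_vec n" using x by (auto simp: u_def intro: mult_mat_vec_carrier[OF rdiag_carrier])
  have "W *\<^sub>v x = rdiag n (g \<circ> \<epsilon>) *\<^sub>v (K *\<^sub>v u)"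
    using K x unfolding u_def by (subst fac) (simp add: assoc_mult_mat_vec[of _ n n _ n] c mult_mat_vec_carrier[of _ n n])
  \<comment> \<open>The real diagonal factor is self-adjoint and moves to \<open>y\<close>;
    Cauchy-Schwarz and the contraction \<open>K\<close> finish.\<close>
  then have "(W *\<^sub>v x) \<bullet>c y = (K *\<^sub>v u) \<bullet>c (rdiag n (g \<circ> \<epsilon>) *\<^sub>v y)"
    using cscalar_prod_adj[OF rdiag_carrier mult_mat_vec_carrier[OF K u] y] by simp
  then have "cmod ((W *\<^sub>v x) \<bullet>c y) \<le> sqrt (vnorm2 (K *\<^sub>v u)) * sqrt (vnorm2 (rdiag n (g \<circ> \<epsilon>) *\<^sub>v y))"
    using cscalar_prod_Cauchy_Schwarz[OF mult_mat_vec_carrier[OF K u] mult_mat_vec_carrier[OF rdiag_carrier y]] by simp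
  also have "\<dots> \<le> sqrt (vnorm2 u) * sqrt (vnorm2 (rdiag n (g \<circ> \<epsilon>) *\<^sub>v y))"
    using contr[OF u] by (intro mult_right_mono) auto
  finally show ?thesis by (simp add: u_def)
qed

text \<open>One pair \<open>U\<close>, \<open>s\<close> serves the Gram matrix and every
  \<open>\<phi>\<close> at once, so all of them are evaluated in the same eigenbasis.\<close>

lemma matfun_square_mabs:
  assumes A: "A \<in> carrier_mat n n"
  obtains U s where "unitary n U" "\<And>j. 0 \<le> s j"
    "adj A * A = U * rdiag n (\<lambda>i. (s i)\<^sup>2) * adj U"
    "\<And>\<phi>. matfun (\<lambda>t. (\<phi> t)\<^sup>2) (mabs A) \<in> carrier_mat n n"
    "\<And>\<phi> x. x \<in> carrier_vec n \<Longrightarrow>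
      (matfun (\<lambda>t. (\<phi> t)\<^sup>2) (mabs A) *\<^sub>v x) \<bullet>c x = vnorm2 (rdiag n (\<phi> \<circ> s) *\<^sub>v (adj U *\<^sub>v x))"
proof -
  from gram_spec_decomp[OF A] obtain U s where U: "unitary n U" "\<And>j. 0 \<le> s j"
    "adj A * A = U * rdiag n (\<lambda>i. (s i)\<^sup>2) * adj U" "spec_decomp (mabs A) U s" "mabs A \<in> carrier_mat n n"
    by metis
  have "(matfun (\<lambda>t. (\<phi> t)\<^sup>2) (mabs A) *\<^sub>v x) \<bullet>c x = vnorm2 (rdiag n (\<phi> \<circ> s) *\<^sub>v (adj U *\<^sub>v x))"
    if "x \<in> carrier_vec n" for \<phi> x
    using quadratic_form_rdiag_square[OF unitary_carrier[OF U(1)] that, of "\<phi> \<circ> s"]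
    by (simp only: matfun_eq[OF U(5,4)] comp_def)
  then show ?thesis using U(1-3) spec_decomp_matfun(1)[OF U(5,4)] by (intro that[of U s])
qed

text \<open>In eigenbases \<open>Y\<close> of \<open>adj T * T\<close> and \<open>X\<close> of
  \<open>T * adj T\<close>, the operator \<open>T\<close> becomes \<open>adj X * (T * Y)\<close>,
  both of whose Gram matrices are diagonal. This reduces the claim to
  \<open>mixed_schwarz_diagonal\<close>.\<close>

lemma mixed_schwarz:
  assumes T: "T \<in> carrier_mat n n" and fg: "\<And>t. 0 \<le> t \<Longrightarrow> f t * g t = t"
    and x: "x \<in> carrier_vec n" and y: "y \<in> carrier_vec n"
  shows "cmod ((T *\<^sub>v x) \<bullet>c y) \<le> sqrt (Re ((matfun (\<lambda>t. (f t)\<^sup>2) (mabs T) *\<^sub>v x) \<bullet>c x))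
    * sqrt (Re ((matfun (\<lambda>t. (g t)\<^sup>2) (mabs (adj T)) *\<^sub>v y) \<bullet>c y))"
proof -
  from matfun_square_mabs[OF T] obtain Y \<delta> where Y: "unitary n Y" "\<And>j. 0 \<le> \<delta> j"
    "adj T * T = Y * rdiag n (\<lambda>i. (\<delta> i)\<^sup>2) * adj Y"
    "\<And>\<phi> x. x \<in> carrier_vec n \<Longrightarrow>
      (matfun (\<lambda>t. (\<phi> t)\<^sup>2) (mabs T) *\<^sub>v x) \<bullet>c x = vnorm2 (rdiag n (\<phi> \<circ> \<delta>) *\<^sub>v (adj Y *\<^sub>v x))"
    by metis
  from matfun_square_mabs[OF adj_carrier[OF T]] obtain X \<epsilon> where X: "unitary n X" "\<And>j. 0 \<le> \<epsilon> j"
    "T * adj T = X * rdiag n (\<lambda>i. (\<epsilon> i)\<^sup>2) * adj X"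
    "\<And>\<phi> x. x \<in> carrier_vec n \<Longrightarrow>
      (matfun (\<lambda>t. (\<phi> t)\<^sup>2) (mabs (adj T)) *\<^sub>v x) \<bullet>c x = vnorm2 (rdiag n (\<phi> \<circ> \<epsilon>) *\<^sub>v (adj X *\<^sub>v x))"
    unfolding adj_adj by metis
  note Yc = unitary_carrier[OF Y(1)] and Xc = unitary_carrier[OF X(1)]
  note c = T Yc Xc adj_carrier[OF T] adj_carrier[OF Yc] adj_carrier[OF Xc]
    assoc_mult_mat[of _ n n _ n _ n] mult_carrier_mat[of _ n n _ n] adj_mult[of _ n n _ n]
    unitary_cancel[OF X(1), of _ n] unitary_cancel[OF Y(1), of _ n]
    right_mult_one_mat[of _ n n] left_mult_one_mat[of _ n n]
  have one: "adj Y * Y = 1\<^sub>m n" "adj X * X = 1\<^sub>m n" "Y * adj Y = 1\<^sub>m n"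
    using X(1) Y(1) by (auto simp: unitary_def)
  define W where "W = adj X * (T * Y)"
  have W: "W \<in> carrier_mat n n" by (simp add: W_def c)
  have "adj W * W = adj Y * (adj T * T) * Y" by (simp add: W_def c)
  also have "\<dots> = rdiag n (\<lambda>i. (\<delta> i)\<^sup>2)" unfolding Y(3) by (simp add: c one)
  finally have W1: "adj W * W = rdiag n (\<lambda>i. (\<delta> i)\<^sup>2)" .
  have "W * adj W = adj X * (T * adj T) * X" by (simp add: W_def c)
  also have "\<dots> = rdiag n (\<lambda>i. (\<epsilon> i)\<^sup>2)" unfolding X(3) by (simp add: c one)
  finally have W2: "W * adj W = rdiag n (\<lambda>i. (\<epsilon> i)\<^sup>2)" .
  have x': "adj Y *\<^sub>v x \<in> carrier_vec n" and y': "adj X *\<^sub>v y \<in> carrier_vec n"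
    using mult_mat_vec_carrier c x y by blast+
  have "T = X * (W * adj Y)" by (simp add: W_def c one)
  then have "T *\<^sub>v x = X * (W * adj Y) *\<^sub>v x" by simp
  also have "\<dots> = X *\<^sub>v (W *\<^sub>v (adj Y *\<^sub>v x))"
    using x W c(2,3,5) by (simp add: assoc_mult_mat_vec[of _ n n _ n] mult_carrier_mat[of _ n n _ n])
  finally have "(T *\<^sub>v x) \<bullet>c y = (W *\<^sub>v (adj Y *\<^sub>v x)) \<bullet>c (adj X *\<^sub>v y)"
    using cscalar_prod_adj[OF Xc mult_mat_vec_carrier[OF W x'] y] by simp
  then show ?thesis
    using mixed_schwarz_diagonal[of W n \<delta> \<epsilon> f g, OF W W1 W2 Y(2) X(2) fg x' y'] Y(4)[OF x] X(4)[OF y] by simp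
qed

lemma matfun_square_mabs_psd:
  assumes "A \<in> carrier_mat n n"
  shows "matfun (\<lambda>t. (\<phi> t)\<^sup>2) (mabs A) \<in> carrier_mat n n"
    and "x \<in> carrier_vec n \<Longrightarrow> 0 \<le> Re ((matfun (\<lambda>t. (\<phi> t)\<^sup>2) (mabs A) *\<^sub>v x) \<bullet>c x)"
proof -
  from matfun_square_mabs[OF assms] obtain U s where
    U: "\<And>\<phi>. matfun (\<lambda>t. (\<phi> t)\<^sup>2) (mabs A) \<in> carrier_mat n n"
    "\<And>\<phi> x. x \<in> carrier_vec n \<Longrightarrow>
      (matfun (\<lambda>t. (\<phi> t)\<^sup>2) (mabs A) *\<^sub>v x) \<bullet>c x = vnorm2 (rdiag n (\<phi> \<circ> s) *\<^sub>v (adj U *\<^sub>v x))"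
    by metis
  show "matfun (\<lambda>t. (\<phi> t)\<^sup>2) (mabs A) \<in> carrier_mat n n" by (rule U(1))
  show "0 \<le> Re ((matfun (\<lambda>t. (\<phi> t)\<^sup>2) (mabs A) *\<^sub>v x) \<bullet>c x)" if "x \<in> carrier_vec n"
    using U(2)[OF that, of \<phi>] by simp
qed

section \<open>From the mixed Schwarz inequality to the Schatten bound\<close>

lemma sqrt_Cauchy_Schwarz2:
  fixes a b c d :: real
  assumes "0 \<le> a" "0 \<le> b" "0 \<le> c" "0 \<le> d"
  shows "sqrt a * sqrt b + sqrt c * sqrt d \<le> sqrt (a + c) * sqrt (b + d)"
  using L2_set_mult_ineq[of "\<lambda>i. if i then sqrt a else sqrt c" "\<lambda>i. if i then sqrt b else sqrt d" UNIV] assms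
  by (simp add: L2_set_def UNIV_bool add.commute)

lemma vnorm2_re_part_le:
  fixes e f g h :: "real \<Rightarrow> real"
  assumes n: "0 < n" and T: "T \<in> carrier_mat n n"
    and fg: "\<And>t. 0 \<le> t \<Longrightarrow> f t * g t = t" and eh: "\<And>t. 0 \<le> t \<Longrightarrow> e t * h t = t"
    and z: "cmod z = 1" and x: "x \<in> carrier_vec n"
  defines "G \<equiv> matfun (\<lambda>t. (g t)\<^sup>2) (mabs (adj T)) + matfun (\<lambda>t. (h t)\<^sup>2) (mabs T)"
    and "B \<equiv> matfun (\<lambda>t. (f t)\<^sup>2) (mabs T) + matfun (\<lambda>t. (e t)\<^sup>2) (mabs (adj T))"
  shows "vnorm2 (re_part (z \<cdot>\<^sub>m T) *\<^sub>v x) \<le> op_norm G / 4 * Re ((B *\<^sub>v x) \<bullet>c x)"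
proof -
  define u where "u = re_part (z \<cdot>\<^sub>m T) *\<^sub>v x"
  note T' = adj_carrier[OF T]
  note car = matfun_square_mabs_psd(1)[OF T] matfun_square_mabs_psd(1)[OF T']
  have quad: "Re (((C + D) *\<^sub>v y) \<bullet>c y) = Re ((C *\<^sub>v y) \<bullet>c y) + Re ((D *\<^sub>v y) \<bullet>c y)"
    if "C \<in> carrier_mat n n" "D \<in> carrier_mat n n" "y \<in> carrier_vec n" for C D y
    using that
    by (simp add: add_mult_distrib_mat_vec[of _ n n] add_scalar_prod_distrib[of _ n] mult_mat_vec_carrier[of _ n n])
  have u: "u \<in> carrier_vec n" using T x by (auto simp: u_def re_part_def intro!: mult_mat_vec_carrier)
  note quadB = quad[OF car(1,2) x, of f e, folded B_def] and quadG = quad[OF car(2,1) u, of g h, folded G_def]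
  have Tx: "T *\<^sub>v x \<in> carrier_vec n" "adj T *\<^sub>v x \<in> carrier_vec n"
    using mult_mat_vec_carrier T T' x by blast+
  have "u = (1 / 2) \<cdot>\<^sub>v (z \<cdot>\<^sub>v (T *\<^sub>v x) + cnj z \<cdot>\<^sub>v (adj T *\<^sub>v x))"
  proof (rule eq_vecI)
    fix i assume "i < dim_vec ((1 / 2) \<cdot>\<^sub>v (z \<cdot>\<^sub>v (T *\<^sub>v x) + cnj z \<cdot>\<^sub>v (adj T *\<^sub>v x)))"
    then have i: "i < n" using T by simp
    show "u $ i = ((1 / 2) \<cdot>\<^sub>v (z \<cdot>\<^sub>v (T *\<^sub>v x) + cnj z \<cdot>\<^sub>v (adj T *\<^sub>v x))) $ i"
      using T x i unfolding u_def re_part_def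
      by (simp add: scalar_prod_def sum.distrib sum_distrib_left sum_divide_distrib algebra_simps add_divide_distrib)
  qed (use T u in auto)
  then have "u \<bullet>c u = ((1 / 2) \<cdot>\<^sub>v (z \<cdot>\<^sub>v (T *\<^sub>v x) + cnj z \<cdot>\<^sub>v (adj T *\<^sub>v x))) \<bullet>c u" by (rule arg_cong)
  also have "\<dots> = 1 / 2 * (z * ((T *\<^sub>v x) \<bullet>c u) + cnj z * ((adj T *\<^sub>v x) \<bullet>c u))"
    using Tx u by (simp add: add_scalar_prod_distrib[of _ n] smult_scalar_prod_distrib[of _ n])
  finally have eq: "u \<bullet>c u = 1 / 2 * (z * ((T *\<^sub>v x) \<bullet>c u) + cnj z * ((adj T *\<^sub>v x) \<bullet>c u))" .
  have "cmod (u \<bullet>c u) \<le> 1 / 2 * (cmod ((T *\<^sub>v x) \<bullet>c u) + cmod ((adj T *\<^sub>v x) \<bullet>c u))"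
    unfolding eq using norm_triangle_ineq[of "z * ((T *\<^sub>v x) \<bullet>c u)" "cnj z * ((adj T *\<^sub>v x) \<bullet>c u)"] z
    by (simp add: norm_mult)
  \<comment> \<open>The \<open>T\<close> term pairs \<open>f\<close> at \<open>x\<close> with
    \<open>g\<close> at \<open>u\<close>, the adjoint term pairs \<open>e\<close> at
    \<open>x\<close> with \<open>h\<close> at \<open>u\<close>. The two-term Cauchy-Schwarz
    inequality collects the forms at \<open>x\<close> into \<open>B\<close> and those at
    \<open>u\<close> into \<open>G\<close>.\<close>
  also have "\<dots> \<le> 1 / 2 * (sqrt (Re ((B *\<^sub>v x) \<bullet>c x)) * sqrt (Re ((G *\<^sub>v u) \<bullet>c u)))"
    using order_trans[OF add_mono[OF mixed_schwarz[OF T fg x u]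
        mixed_schwarz[OF T' eh x u, unfolded adj_adj]]
      sqrt_Cauchy_Schwarz2[OF matfun_square_mabs_psd(2)[OF T x] matfun_square_mabs_psd(2)[OF T' u]
        matfun_square_mabs_psd(2)[OF T' x] matfun_square_mabs_psd(2)[OF T u]]]
    by (simp add: quadB quadG)
  finally have le: "vnorm2 u \<le> 1 / 2 * (sqrt (Re ((B *\<^sub>v x) \<bullet>c x)) * sqrt (Re ((G *\<^sub>v u) \<bullet>c u)))"
    by (simp add: cscalar_prod_self)
  have G: "G \<in> carrier_mat n n" using car by (simp add: G_def)
  have Bx: "0 \<le> Re ((B *\<^sub>v x) \<bullet>c x)"
    unfolding quadB using matfun_square_mabs_psd(2)[OF T x, of f] matfun_square_mabs_psd(2)[OF T' x, of e] by simp
  have c: "0 \<le> op_norm G" "Re ((G *\<^sub>v u) \<bullet>c u) \<le> op_norm G * vnorm2 u"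
    using quadratic_form_le_op_norm[OF G u n] by auto
  have "vnorm2 u \<le> 1 / 2 * (sqrt (Re ((B *\<^sub>v x) \<bullet>c x)) * sqrt (op_norm G * vnorm2 u))"
    using le mult_left_mono[OF real_sqrt_le_mono[OF c(2)], of "sqrt (Re ((B *\<^sub>v x) \<bullet>c x))"] Bx by simp
  then have "(vnorm2 u)\<^sup>2 \<le> (1 / 2 * (sqrt (Re ((B *\<^sub>v x) \<bullet>c x)) * sqrt (op_norm G * vnorm2 u)))\<^sup>2"
    by (intro power_mono) auto
  also have "\<dots> = (op_norm G / 4 * Re ((B *\<^sub>v x) \<bullet>c x)) * vnorm2 u"
    using Bx c(1) by (simp add: power_mult_distrib power_divide)
  finally have "vnorm2 u * vnorm2 u \<le> (op_norm G / 4 * Re ((B *\<^sub>v x) \<bullet>c x)) * vnorm2 u"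
    by (simp add: power2_eq_square)
  \<comment> \<open>A common factor \<open>vnorm2 u\<close> cancels; if it is zero, the right side
    is nonnegative anyway.\<close>
  then have "vnorm2 u \<le> op_norm G / 4 * Re ((B *\<^sub>v x) \<bullet>c x)"
    using Bx c(1) vnorm2_nonneg[of u] by (cases "vnorm2 u = 0") (auto simp: mult_le_cancel_right)
  then show ?thesis by (simp add: u_def)
qed

text \<open>The form inequality compares the counting functions of the squared singular values of
  \<open>Q\<close> and of \<open>\<kappa>\<close> times those of \<open>B\<close>, so
  \<open>sum_mono_of_counting\<close> applies with the power \<open>p / 2\<close>, which is monotone
  for every positive \<open>p\<close>.\<close>

lemma schatten_le:
  assumes Q: "Q \<in> carrier_mat n n" and B: "B \<in> carrier_mat n n" and \<kappa>: "0 \<le> \<kappa>" and p: "0 < p"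
    and le: "\<And>x. x \<in> carrier_vec n \<Longrightarrow> vnorm2 (Q *\<^sub>v x) \<le> \<kappa> * Re ((B *\<^sub>v x) \<bullet>c x)"
  shows "schatten p Q \<le> sqrt \<kappa> * sqrt (schatten (p / 2) B)"
proof -
  have sQ: "0 \<le> sing_vals Q j" if "j < n" for j using sing_vals_expansion[OF Q] that by metis
  have sB: "0 \<le> sing_vals B j" if "j < n" for j using sing_vals_expansion[OF B] that by metis
  have "(\<Sum>j<n. (sing_vals Q j)\<^sup>2 powr (p / 2)) \<le> (\<Sum>j<n. (\<kappa> * sing_vals B j) powr (p / 2))"
  proof (rule sum_mono_of_counting[where \<phi> = "\<lambda>t. t powr (p / 2)"
        and a = "\<lambda>j. (sing_vals Q j)\<^sup>2" and b = "\<lambda>j. \<kappa> * sing_vals B j"])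
    fix t :: real assume t: "0 \<le> t"
    show "card {i \<in> {..<n}. t < (sing_vals Q i)\<^sup>2} \<le> card {j \<in> {..<n}. t < \<kappa> * sing_vals B j}"
    proof (cases "\<kappa> = 0")
      \<comment> \<open>Dividing the threshold by \<open>\<kappa>\<close> is impossible here. A
        threshold no singular value of \<open>B\<close> exceeds makes the right count zero, and
        multiplied by \<open>\<kappa>\<close> it is still 0; inserting 0 keeps the maximum defined
        and nonnegative when \<open>n = 0\<close>.\<close>
      case True
      have "card {i \<in> {..<n}. t < (sing_vals Q i)\<^sup>2} \<le> card {i \<in> {..<n}. \<kappa> * Max (insert 0 (sing_vals B ` {..<n})) < (sing_vals Q i)\<^sup>2}"
        using t True by (intro card_mono) auto
      also have "\<dots> \<le> card {j\<in>{..<n}. Max (insert 0 (sing_vals B ` {..<n})) < sing_vals B j}"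
        using \<kappa> le by (intro card_sing_vals_le[OF Q B]) auto
      also have "{j\<in>{..<n}. Max (insert 0 (sing_vals B ` {..<n})) < sing_vals B j} = {}"
        by (auto simp: not_less)
      finally show ?thesis by (simp only: card.empty le_zero_eq le0)
    next
      case False
      then have "\<kappa> * (t / \<kappa>) = t" "\<And>j. t / \<kappa> < sing_vals B j \<longleftrightarrow> t < \<kappa> * sing_vals B j"
        using \<kappa> by (auto simp: field_simps)
      then show ?thesis using card_sing_vals_le[OF Q B \<kappa> _ le, of "t / \<kappa>"] t \<kappa> by simp
    qed
  qed (use sB \<kappa> p in \<open>auto intro: powr_mono2\<close>)
  moreover have "(sing_vals Q j)\<^sup>2 powr (p / 2) = sing_vals Q j powr p" if "j < n" for j
    using sQ[OF that] by (cases "sing_vals Q j = 0") (simp_all add: powr_powr flip: powr_numeral)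
  moreover have "(\<kappa> * sing_vals B j) powr (p / 2) = \<kappa> powr (p / 2) * sing_vals B j powr (p / 2)" if "j < n" for j
    using sB[OF that] \<kappa> by (simp add: powr_mult)
  ultimately have "(\<Sum>j<n. sing_vals Q j powr p) \<le> \<kappa> powr (p / 2) * (\<Sum>j<n. sing_vals B j powr (p / 2))"
    by (simp add: sum_distrib_left)
  then have "schatten p Q \<le> (\<kappa> powr (p / 2) * (\<Sum>j<n. sing_vals B j powr (p / 2))) powr (1 / p)"
    unfolding schatten_def using Q p by (auto intro!: powr_mono2 sum_nonneg)
  also have "\<dots> = \<kappa> powr (1 / 2) * (\<Sum>j<n. sing_vals B j powr (p / 2)) powr (1 / p)"
    using p by (simp add: powr_mult powr_powr sum_nonneg)
  \<comment> \<open>The outer exponent in \<open>schatten (p / 2) B\<close> is \<open>2 / p\<close>,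
    so its square root has exponent \<open>1 / p\<close>.\<close>
  also have "\<dots> = sqrt \<kappa> * sqrt (schatten (p / 2) B)"
    using \<kappa> p B by (simp add: schatten_def powr_half_sqrt[symmetric] powr_powr)
  finally show ?thesis .
qed

theorem theorem4p6:
  fixes T :: "complex mat" and n :: nat and e f g h :: "real \<Rightarrow> real" and p :: real
  assumes "0 < n" and "T \<in> carrier_mat n n"
    and "continuous_on {0..} e" "continuous_on {0..} f"
    and "continuous_on {0..} g" "continuous_on {0..} h"
    and "\<And>t. t \<ge> 0 \<Longrightarrow> e t \<ge> 0 \<and> f t \<ge> 0 \<and> g t \<ge> 0 \<and> h t \<ge> 0"
    and "\<And>t. t \<ge> 0 \<Longrightarrow> f t * g t = t"
    and "\<And>t. t \<ge> 0 \<Longrightarrow> e t * h t = t"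
    and "0 < p"
  shows "w_p p T \<le> 1/2
    * sqrt (op_norm (matfun (\<lambda>t. (g t)^2) (mabs (adj T)) + matfun (\<lambda>t. (h t)^2) (mabs T)))
    * sqrt (schatten (p/2) (matfun (\<lambda>t. (f t)^2) (mabs T) + matfun (\<lambda>t. (e t)^2) (mabs (adj T))))"
    (is "_ \<le> 1/2 * sqrt (op_norm ?G) * sqrt (schatten (p/2) ?B)")
proof -
  note car = matfun_square_mabs_psd(1)[OF assms(2)] matfun_square_mabs_psd(1)[OF adj_carrier[OF assms(2)]]
  have G: "?G \<in> carrier_mat n n" and B: "?B \<in> carrier_mat n n" using car by simp_all
  have c: "0 \<le> op_norm ?G / 4" using quadratic_form_le_op_norm(1)[OF G zero_carrier_vec assms(1)] by simp
  have "schatten p (re_part (z \<cdot>\<^sub>m T)) \<le> 1/2 * sqrt (op_norm ?G) * sqrt (schatten (p/2) ?B)" if "cmod z = 1" for z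
  proof -
    have "re_part (z \<cdot>\<^sub>m T) \<in> carrier_mat n n" using assms(2) by (simp add: re_part_def)
    \<comment> \<open>The quarter inside \<open>\<kappa>\<close> leaves the square root as the
      factor 1/2.\<close>
    from schatten_le[OF this B c assms(10) vnorm2_re_part_le[OF assms(1,2,8,9) that]]
    show ?thesis by (simp add: real_sqrt_divide)
  qed
  moreover have "{z. cmod z = 1} \<noteq> {}" by (auto intro: exI[of _ 1])
  \<comment> \<open>The bound is uniform in \<open>z\<close>, so it passes to the supremum over the
    nonempty unit circle.\<close>
  ultimately show ?thesis unfolding w_p_def by (intro cSUP_least) auto
qed

end
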